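(* Let $(A,d)$ be a dg-algebra. If the graded ring $\ker(d)$ is gr-prime, then $(A,d)$ is dg-prime.
   Context: A dg-algebra $(A,d)$ is an associative unital $\mathbb Z$-graded algebra with an endomorphism $d$ of degree $1$, $d^2=0$, $d(ab)=d(a)b+(-1)^{|a|}a\,d(b)$ for $a$ homogeneous; $\ker(d)$ is a graded subalgebra. A two-sided dg-ideal is a graded two-sided ideal stable under $d$. $(A,d)$ is dg-prime if for two-sided dg-ideals $I,J$ of $(A,d)$, $IJ=0$ implies $I=0$ or $J=0$. A graded ring is gr-prime if for graded two-sided ideals $I,J$, $IJ=0$ implies $I=0$ or $J=0$. *)

theory Defs
  imports "HOL-Algebra.Algebra"
begin

definition homogeneous_decomp ::
    "('a, 'm) ring_scheme \<Rightarrow> (int \<Rightarrow> 'a set) \<Rightarrow> (int \<Rightarrow> 'a) \<Rightarrow> 'a \<Rightarrow> bool" where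
  "homogeneous_decomp R G f x \<longleftrightarrow>
     (\<forall>i. f i \<in> G i) \<and> finite {i. f i \<noteq> \<zero>\<^bsub>R\<^esub>} \<and>
     x = (\<Oplus>\<^bsub>R\<^esub> i \<in> {i. f i \<noteq> \<zero>\<^bsub>R\<^esub>}. f i)"

(* one_degree is implied by the other axioms; it is listed for convenience. *)
locale graded_ring = ring R
  for R :: "('a, 'm) ring_scheme" (structure) and G :: "int \<Rightarrow> 'a set" +
  assumes component_subgroup: "additive_subgroup (G i) R"
    and direct_sum: "x \<in> carrier R \<Longrightarrow> \<exists>!f. homogeneous_decomp R G f x"
    and mult_degree: "\<lbrakk>x \<in> G i; y \<in> G j\<rbrakk> \<Longrightarrow> x \<otimes> y \<in> G (i + j)"
    and one_degree: "\<one> \<in> G 0"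

(* The second conjunct says that I is the sum of its subgroups I \<inter> G i; the sum is
   direct because that of the G i is. *)
definition graded_ideal ::
    "'a set \<Rightarrow> ('a, 'm) ring_scheme \<Rightarrow> (int \<Rightarrow> 'a set) \<Rightarrow> bool" where
  "graded_ideal I R G \<longleftrightarrow>
     ideal I R \<and> (\<forall>x\<in>I. \<exists>f. homogeneous_decomp R (\<lambda>i. I \<inter> G i) f x)"

(* Meant for graded rings R with grading G. The zero ring counts as gr-prime. *)
definition gr_prime :: "('a, 'm) ring_scheme \<Rightarrow> (int \<Rightarrow> 'a set) \<Rightarrow> bool" where
  "gr_prime R G \<longleftrightarrow>
     (\<forall>I J. graded_ideal I R G \<and> graded_ideal J R G \<and> ideal_prod R I J = {\<zero>\<^bsub>R\<^esub>}
        \<longrightarrow> I = {\<zero>\<^bsub>R\<^esub>} \<or> J = {\<zero>\<^bsub>R\<^esub>})"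

(* The library locale "algebra" requires the algebra itself to be commutative. *)
locale assoc_algebra = module K A + ring A for K (structure) and A (structure) +
  assumes smult_mult_left:
      "\<lbrakk>k \<in> carrier K; x \<in> carrier A; y \<in> carrier A\<rbrakk> \<Longrightarrow>
       (k \<odot>\<^bsub>A\<^esub> x) \<otimes>\<^bsub>A\<^esub> y = k \<odot>\<^bsub>A\<^esub> (x \<otimes>\<^bsub>A\<^esub> y)"
    and smult_mult_right:
      "\<lbrakk>k \<in> carrier K; x \<in> carrier A; y \<in> carrier A\<rbrakk> \<Longrightarrow>
       x \<otimes>\<^bsub>A\<^esub> (k \<odot>\<^bsub>A\<^esub> y) = k \<odot>\<^bsub>A\<^esub> (x \<otimes>\<^bsub>A\<^esub> y)"

locale graded_algebra = assoc_algebra K A + graded_ring A G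
  for K (structure) and A (structure) and G +
  assumes smult_degree: "\<lbrakk>k \<in> carrier K; x \<in> G i\<rbrakk> \<Longrightarrow> k \<odot>\<^bsub>A\<^esub> x \<in> G i"

definition degree_sign :: "('a, 'm) ring_scheme \<Rightarrow> int \<Rightarrow> 'a" where
  "degree_sign R i = (if even i then \<one>\<^bsub>R\<^esub> else \<ominus>\<^bsub>R\<^esub> \<one>\<^bsub>R\<^esub>)"

locale dg_algebra = graded_algebra K A G
  for K :: "('k, 'n) ring_scheme" (structure) and A :: "('k, 'a, 'm) module_scheme" (structure)
    and G +
  fixes d :: "'a \<Rightarrow> 'a"
  assumes d_closed: "x \<in> carrier A \<Longrightarrow> d x \<in> carrier A"
    and d_add: "\<lbrakk>x \<in> carrier A; y \<in> carrier A\<rbrakk> \<Longrightarrow> d (x \<oplus>\<^bsub>A\<^esub> y) = d x \<oplus>\<^bsub>A\<^esub> d y"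
    and d_smult: "\<lbrakk>k \<in> carrier K; x \<in> carrier A\<rbrakk> \<Longrightarrow> d (k \<odot>\<^bsub>A\<^esub> x) = k \<odot>\<^bsub>A\<^esub> d x"
    and d_degree: "x \<in> G i \<Longrightarrow> d x \<in> G (i + 1)"
    and d_squared: "x \<in> carrier A \<Longrightarrow> d (d x) = \<zero>\<^bsub>A\<^esub>"
    and leibniz: "\<lbrakk>a \<in> G i; b \<in> carrier A\<rbrakk> \<Longrightarrow>
       d (a \<otimes>\<^bsub>A\<^esub> b) = d a \<otimes>\<^bsub>A\<^esub> b \<oplus>\<^bsub>A\<^esub> degree_sign A i \<otimes>\<^bsub>A\<^esub> (a \<otimes>\<^bsub>A\<^esub> d b)"

(* Ideals of a unital algebra are automatically stable under scalars. *)
definition dg_ideal ::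
    "'a set \<Rightarrow> ('a, 'm) ring_scheme \<Rightarrow> (int \<Rightarrow> 'a set) \<Rightarrow> ('a \<Rightarrow> 'a) \<Rightarrow> bool" where
  "dg_ideal I A G d \<longleftrightarrow> graded_ideal I A G \<and> d ` I \<subseteq> I"

definition dg_prime ::
    "('a, 'm) ring_scheme \<Rightarrow> (int \<Rightarrow> 'a set) \<Rightarrow> ('a \<Rightarrow> 'a) \<Rightarrow> bool" where
  "dg_prime A G d \<longleftrightarrow>
     (\<forall>I J. dg_ideal I A G d \<and> dg_ideal J A G d \<and> ideal_prod A I J = {\<zero>\<^bsub>A\<^esub>}
        \<longrightarrow> I = {\<zero>\<^bsub>A\<^esub>} \<or> J = {\<zero>\<^bsub>A\<^esub>})"

definition ker_ring ::
    "('a, 'm) ring_scheme \<Rightarrow> ('a \<Rightarrow> 'a) \<Rightarrow> ('a, 'm) ring_scheme" where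
  "ker_ring A d = A\<lparr>carrier := a_kernel A A d\<rparr>"

definition ker_grading ::
    "('a, 'm) ring_scheme \<Rightarrow> (int \<Rightarrow> 'a set) \<Rightarrow> ('a \<Rightarrow> 'a) \<Rightarrow> int \<Rightarrow> 'a set" where
  "ker_grading A G d i = G i \<inter> a_kernel A A d"

context dg_algebra
begin

lemma mem_ker: "x \<in> a_kernel A A d \<longleftrightarrow> x \<in> carrier A \<and> d x = \<zero>\<^bsub>A\<^esub>"
  by (simp add: a_kernel_def')

lemma component_closed: "x \<in> G i \<Longrightarrow> x \<in> carrier A"
  using component_subgroup additive_subgroup.a_Hcarr by metis

lemma d_zero: "d \<zero>\<^bsub>A\<^esub> = \<zero>\<^bsub>A\<^esub>"
  using d_add[of "\<zero>\<^bsub>A\<^esub>" "\<zero>\<^bsub>A\<^esub>"] d_closed[of "\<zero>\<^bsub>A\<^esub>"] M.add.l_cancel_one by auto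

lemma d_minus: "x \<in> carrier A \<Longrightarrow> d (\<ominus>\<^bsub>A\<^esub> x) = \<ominus>\<^bsub>A\<^esub> d x"
  using d_add[of "\<ominus>\<^bsub>A\<^esub> x" x] d_zero d_closed
  by (metis M.add.inv_closed M.l_neg M.minus_equality)

lemma d_finsum:
  assumes "finite S" "f \<in> S \<rightarrow> carrier A"
  shows "d (finsum A f S) = finsum A (d \<circ> f) S"
  using assms
proof (induction S)
  case empty
  then show ?case by (simp add: d_zero)
next
  case (insert a S)
  then have "f \<in> S \<rightarrow> carrier A" "f a \<in> carrier A" "d \<circ> f \<in> S \<rightarrow> carrier A"
    using d_closed by (auto simp: Pi_iff)
  with insert show ?case by (simp add: d_add d_closed comp_def)
qed

lemma d_one: "d \<one>\<^bsub>A\<^esub> = \<zero>\<^bsub>A\<^esub>"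
  using leibniz[OF one_degree, of "\<one>\<^bsub>A\<^esub>"] d_closed[of "\<one>\<^bsub>A\<^esub>"] M.add.l_cancel_one
  by (simp add: degree_sign_def)

lemma zero_decomp_unique:
  assumes "homogeneous_decomp A G f \<zero>\<^bsub>A\<^esub>"
  shows "f i = \<zero>\<^bsub>A\<^esub>"
proof -
  have "homogeneous_decomp A G (\<lambda>_. \<zero>\<^bsub>A\<^esub>) \<zero>\<^bsub>A\<^esub>"
    by (simp add: homogeneous_decomp_def additive_subgroup.zero_closed[OF component_subgroup])
  then have "f = (\<lambda>_. \<zero>\<^bsub>A\<^esub>)"
    using assms direct_sum[of "\<zero>\<^bsub>A\<^esub>"] by blast
  then show ?thesis by simp
qed

lemma ker_decomp:
  assumes "homogeneous_decomp A G f x" "d x = \<zero>\<^bsub>A\<^esub>"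
  shows "d (f i) = \<zero>\<^bsub>A\<^esub>"
proof -
  let ?S = "{i. f i \<noteq> \<zero>\<^bsub>A\<^esub>}"
  define g where "g j = d (f (j - 1))" for j
  from assms(1) have fG: "\<And>i. f i \<in> G i" and fin: "finite ?S" and x: "x = finsum A f ?S"
    by (auto simp: homogeneous_decomp_def)
  have fc: "f i \<in> carrier A" for i using fG component_closed by blast
  have gc: "g j \<in> carrier A" for j using fc d_closed g_def by auto
  have sub: "{j. g j \<noteq> \<zero>\<^bsub>A\<^esub>} \<subseteq> (\<lambda>i. i + 1) ` ?S"
  proof
    fix j assume "j \<in> {j. g j \<noteq> \<zero>\<^bsub>A\<^esub>}"
    then have "j - 1 \<in> ?S" using d_zero by (auto simp: g_def)
    then show "j \<in> (\<lambda>i. i + 1) ` ?S" by (rule rev_image_eqI) simp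
  qed
  have "d x = finsum A (d \<circ> f) ?S"
    unfolding x using fin fc by (intro d_finsum) auto
  also have "\<dots> = (\<Oplus>\<^bsub>A\<^esub> i \<in> ?S. g (i + 1))"
    using gc fc d_closed by (intro M.finsum_cong') (auto simp: g_def)
  also have "\<dots> = finsum A g ((\<lambda>i. i + 1) ` ?S)"
    using gc by (intro M.add.finprod_reindex[symmetric]) (auto simp: inj_on_def)
  also have "\<dots> = finsum A g {j. g j \<noteq> \<zero>\<^bsub>A\<^esub>}"
    using sub fin gc by (intro M.add.finprod_mono_neutral_cong_right) auto
  finally have "\<zero>\<^bsub>A\<^esub> = finsum A g {j. g j \<noteq> \<zero>\<^bsub>A\<^esub>}"
    using assms(2) by simp
  moreover have "finite {j. g j \<noteq> \<zero>\<^bsub>A\<^esub>}"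
    using finite_subset[OF sub] fin by blast
  moreover have "g j \<in> G j" for j
    using d_degree[OF fG, of "j - 1"] by (simp add: g_def)
  ultimately have "homogeneous_decomp A G g \<zero>\<^bsub>A\<^esub>"
    by (simp add: homogeneous_decomp_def)
  from zero_decomp_unique[OF this, of "i + 1"] show ?thesis by (simp add: g_def)
qed

lemma ker_mult:
  assumes x: "x \<in> a_kernel A A d" and y: "y \<in> a_kernel A A d"
  shows "x \<otimes>\<^bsub>A\<^esub> y \<in> a_kernel A A d"
proof -
  obtain f where f: "homogeneous_decomp A G f x" using direct_sum x mem_ker by blast
  let ?S = "{i. f i \<noteq> \<zero>\<^bsub>A\<^esub>}"
  from f have fG: "\<And>i. f i \<in> G i" and fin: "finite ?S" and xs: "x = finsum A f ?S"
    by (auto simp: homogeneous_decomp_def)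
  have fc: "f i \<in> carrier A" for i using fG component_closed by blast
  have df: "d (f i) = \<zero>\<^bsub>A\<^esub>" for i using ker_decomp f x mem_ker by blast
  have yc: "y \<in> carrier A" "d y = \<zero>\<^bsub>A\<^esub>" using y mem_ker by auto
  have sc: "degree_sign A i \<in> carrier A" for i by (simp add: degree_sign_def)
  have z: "d (f i \<otimes>\<^bsub>A\<^esub> y) = \<zero>\<^bsub>A\<^esub>" for i
    using leibniz[OF fG yc(1)] df yc fc sc by simp
  have "x \<otimes>\<^bsub>A\<^esub> y = (\<Oplus>\<^bsub>A\<^esub> i \<in> ?S. f i \<otimes>\<^bsub>A\<^esub> y)"
    unfolding xs using fin fc yc by (intro finsum_ldistr) auto
  then have "d (x \<otimes>\<^bsub>A\<^esub> y) = finsum A (d \<circ> (\<lambda>i. f i \<otimes>\<^bsub>A\<^esub> y)) ?S"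
    using d_finsum[OF fin, of "\<lambda>i. f i \<otimes>\<^bsub>A\<^esub> y"] fc yc by auto
  also have "\<dots> = \<zero>\<^bsub>A\<^esub>" using z by (simp add: comp_def)
  finally show ?thesis using x yc mem_ker by auto
qed

lemma ker_subring: "subring (a_kernel A A d) A"
  by (rule subringI) (auto simp: mem_ker d_one d_minus d_add intro: ker_mult[unfolded mem_ker, THEN conjunct2])

lemma finsum_ker_ring:
  assumes "finite S" "f \<in> S \<rightarrow> a_kernel A A d"
  shows "finsum (ker_ring A d) f S = finsum A f S"
proof -
  interpret B: ring "ker_ring A d"
    using subring_is_ring[OF ker_subring] by (simp add: ker_ring_def)
  have c: "carrier (ker_ring A d) = a_kernel A A d"
    and p: "\<And>x y. x \<oplus>\<^bsub>ker_ring A d\<^esub> y = x \<oplus>\<^bsub>A\<^esub> y" and z: "\<zero>\<^bsub>ker_ring A d\<^esub> = \<zero>\<^bsub>A\<^esub>"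
    by (simp_all add: ker_ring_def)
  show ?thesis using assms
  proof (induction S)
    case empty
    then show ?case by (simp add: z)
  next
    case (insert a S)
    then have "f \<in> S \<rightarrow> a_kernel A A d" "f a \<in> a_kernel A A d" by auto
    moreover from this have "f \<in> S \<rightarrow> carrier A" "f a \<in> carrier A"
      by (auto simp: mem_ker)
    ultimately show ?case using insert by (simp add: c p)
  qed
qed

lemma ker_homogeneous_decomp:
  assumes "x \<in> a_kernel A A d"
  shows "homogeneous_decomp (ker_ring A d) (ker_grading A G d) f x \<longleftrightarrow>
         homogeneous_decomp A G f x"
proof -
  have z: "\<zero>\<^bsub>ker_ring A d\<^esub> = \<zero>\<^bsub>A\<^esub>" by (simp add: ker_ring_def)
  have k: "f i \<in> a_kernel A A d" if "homogeneous_decomp A G f x" for i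
    using that ker_decomp[OF that] assms component_closed[of "f i" i] mem_ker
    by (auto simp: homogeneous_decomp_def)
  show ?thesis
    using k finsum_ker_ring[of "{i. f i \<noteq> \<zero>\<^bsub>A\<^esub>}" f]
    by (auto simp: homogeneous_decomp_def ker_grading_def z Pi_def)
qed

text \<open>The kernel of the differential is a graded ring, so \<^const>\<open>gr_prime\<close> applies to it.\<close>

theorem ker_graded_ring: "graded_ring (ker_ring A d) (ker_grading A G d)"
proof -
  interpret B: ring "ker_ring A d"
    using subring_is_ring[OF ker_subring] by (simp add: ker_ring_def)
  show ?thesis
  proof (intro graded_ring.intro graded_ring_axioms.intro B.ring_axioms)
    fix i
    have s: "subgroup (ker_grading A G d i) (add_monoid A)"
      unfolding ker_grading_def
      using component_subgroup[of i, unfolded additive_subgroup_def]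
        subring.axioms(1)[OF ker_subring]
      by (rule M.add.subgroups_Inter_pair)
    have "subgroup (ker_grading A G d i) ((add_monoid A)\<lparr>carrier := a_kernel A A d\<rparr>)"
      using s subring.axioms(1)[OF ker_subring]
      by (intro M.add.subgroup_incl) (auto simp: ker_grading_def)
    then show "additive_subgroup (ker_grading A G d i) (ker_ring A d)"
      by (simp add: additive_subgroup_def ker_ring_def)
  next
    fix x assume "x \<in> carrier (ker_ring A d)"
    then have x: "x \<in> a_kernel A A d" by (simp add: ker_ring_def)
    then show "\<exists>!f. homogeneous_decomp (ker_ring A d) (ker_grading A G d) f x"
      using direct_sum[of x] by (simp add: ker_homogeneous_decomp mem_ker)
  next
    fix x y i j assume "x \<in> ker_grading A G d i" "y \<in> ker_grading A G d j"
    then show "x \<otimes>\<^bsub>ker_ring A d\<^esub> y \<in> ker_grading A G d (i + j)"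
      by (auto simp: ker_grading_def ker_ring_def mult_degree ker_mult)
  next
    show "\<one>\<^bsub>ker_ring A d\<^esub> \<in> ker_grading A G d 0"
      by (simp add: ker_grading_def ker_ring_def one_degree mem_ker d_one)
  qed
qed

end

end

theory Submission
  imports Defs
begin

text \<open>A dg-ideal that meets the kernel of the differential trivially vanishes: \<open>d\<close> maps it
  into its intersection with the kernel, hence to zero, so it lies in the kernel. Intersecting
  two dg-ideals whose product is zero with the kernel gives graded ideals of the kernel whose
  product is zero.\<close>

text \<open>Multipliers come from \<open>S\<close> only: a product with an element of
  \<open>I \<inter> S\<close> stays in \<open>I\<close> because \<open>S\<close> lies in
  \<open>carrier R\<close>, and in \<open>S\<close> because \<open>S\<close> is closed under
  multiplication.\<close>

lemma (in ring) ideal_Int_subring: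
  assumes "ideal I R" "subring S R"
  shows "ideal (I \<inter> S) (R\<lparr>carrier := S\<rparr>)"
proof (rule idealI)
  show "ring (R\<lparr>carrier := S\<rparr>)"
    using assms(2) by (rule subring_is_ring)
  have I: "subgroup I (add_monoid R)"
    using assms(1) by (simp add: ideal_def additive_subgroup_def)
  have S: "subgroup S (add_monoid R)"
    using assms(2) by (rule subring.axioms)
  have "subgroup (I \<inter> S) ((add_monoid R)\<lparr>carrier := S\<rparr>)"
    using add.subgroup_incl[OF add.subgroups_Inter_pair[OF I S] S] by simp
  then show "subgroup (I \<inter> S) (add_monoid (R\<lparr>carrier := S\<rparr>))" by simp
  fix a x
  assume a: "a \<in> I \<inter> S" and x: "x \<in> carrier (R\<lparr>carrier := S\<rparr>)"
  then have "x \<in> carrier R" using subringE(1)[OF assms(2)] by auto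
  with a x show "x \<otimes>\<^bsub>R\<lparr>carrier := S\<rparr>\<^esub> a \<in> I \<inter> S"
    and "a \<otimes>\<^bsub>R\<lparr>carrier := S\<rparr>\<^esub> x \<in> I \<inter> S"
    using ideal.I_l_closed[OF assms(1)] ideal.I_r_closed[OF assms(1)]
      subringE(6)[OF assms(2)] by auto
qed

text \<open>Elementwise products generate \<open>ideal_prod\<close> additively, so its vanishing can
  be tested on them. In this form the condition passes from \<open>A\<close> to the kernel.\<close>

lemma (in ring) ideal_prod_zero_iff:
  assumes "ideal I R" "ideal J R"
  shows "ideal_prod R I J = {\<zero>} \<longleftrightarrow> (\<forall>i\<in>I. \<forall>j\<in>J. i \<otimes> j = \<zero>)"
proof
  assume "ideal_prod R I J = {\<zero>}"
  then show "\<forall>i\<in>I. \<forall>j\<in>J. i \<otimes> j = \<zero>"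
    using ideal_prod.prod[of _ I _ J R] by auto
next
  assume zero: "\<forall>i\<in>I. \<forall>j\<in>J. i \<otimes> j = \<zero>"
  \<comment> \<open>Induction over the generation of \<open>ideal_prod\<close> by products and
    sums.\<close>
  have "x = \<zero>" if "x \<in> ideal_prod R I J" for x
    using that by induction (simp_all add: zero)
  moreover have "\<zero> \<in> ideal_prod R I J"
    using ideal_prod_is_ideal[OF assms] additive_subgroup.zero_closed ideal.axioms(1) by blast
  ultimately show "ideal_prod R I J = {\<zero>}" by blast
qed

context dg_algebra
begin

text \<open>Since \<open>d\<close> shifts all degrees by one, the homogeneous components of a cycle
  are cycles. The decomposition of \<open>x\<close> inside \<open>I\<close> therefore already lies
  in the kernel.\<close>

lemma graded_ideal_Int_ker:
  assumes "graded_ideal I A G"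
  shows "graded_ideal (I \<inter> a_kernel A A d) (ker_ring A d) (ker_grading A G d)"
  unfolding graded_ideal_def
proof (intro conjI ballI)
  show "ideal (I \<inter> a_kernel A A d) (ker_ring A d)"
    using assms ideal_Int_subring[OF _ ker_subring] by (simp add: graded_ideal_def ker_ring_def)
next
  fix x assume x: "x \<in> I \<inter> a_kernel A A d"
  then obtain f where f: "homogeneous_decomp A (\<lambda>i. I \<inter> G i) f x"
    using assms by (auto simp: graded_ideal_def)
  then have "homogeneous_decomp A G f x"
    by (simp add: homogeneous_decomp_def)
  with x have "homogeneous_decomp (ker_ring A d) (ker_grading A G d) f x"
    by (simp add: ker_homogeneous_decomp)
  \<comment> \<open>The decomposition in \<open>I\<close> gives \<open>f i \<in> I\<close>; the one
    in \<open>ker_ring A d\<close> gives \<open>f i\<close> in the kernel and the sum formed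
    there.\<close>
  with f have "homogeneous_decomp (ker_ring A d)
      (\<lambda>i. (I \<inter> a_kernel A A d) \<inter> ker_grading A G d i) f x"
    by (auto simp: homogeneous_decomp_def ker_grading_def)
  then show "\<exists>f. homogeneous_decomp (ker_ring A d)
      (\<lambda>i. (I \<inter> a_kernel A A d) \<inter> ker_grading A G d i) f x" by blast
qed

lemma dg_ideal_eq_zeroI:
  assumes "dg_ideal I A G d" and ker: "I \<inter> a_kernel A A d = {\<zero>\<^bsub>A\<^esub>}"
  shows "I = {\<zero>\<^bsub>A\<^esub>}"
proof -
  have "ideal I A" and stable: "d ` I \<subseteq> I"
    using assms(1) by (auto simp: dg_ideal_def graded_ideal_def)
  then have I: "I \<subseteq> carrier A"
    using ideal.Icarr by fastforce
  have "d x = \<zero>\<^bsub>A\<^esub>" if "x \<in> I" for x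
  proof -
    \<comment> \<open>Stability puts \<open>d x\<close> in \<open>I\<close>, and d^2 = 0 puts it in
      the kernel.\<close>
    have "d x \<in> I \<inter> a_kernel A A d"
      using that I stable by (auto simp: mem_ker d_squared d_closed)
    with ker show ?thesis by simp
  qed
  then have "I \<subseteq> a_kernel A A d"
    using I by (auto simp: mem_ker)
  with ker show ?thesis by blast
qed

end

theorem lemma7p1:
  fixes K :: "('k, 'n) ring_scheme" and A :: "('k, 'a, 'm) module_scheme"
    and G :: "int \<Rightarrow> 'a set" and d :: "'a \<Rightarrow> 'a"
  assumes "dg_algebra K A G d"
    and "gr_prime (ker_ring A d) (ker_grading A G d)"
  shows "dg_prime A G d"
  unfolding dg_prime_def
proof (intro allI impI, elim conjE)
  interpret dg_algebra K A G d by fact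
  interpret B: graded_ring "ker_ring A d" "ker_grading A G d" by (rule ker_graded_ring)
  fix I J
  assume I: "dg_ideal I A G d" and J: "dg_ideal J A G d" and "ideal_prod A I J = {\<zero>\<^bsub>A\<^esub>}"
  moreover from I J have "ideal I A" "ideal J A"
    by (auto simp: dg_ideal_def graded_ideal_def)
  ultimately have IJ: "\<forall>i\<in>I. \<forall>j\<in>J. i \<otimes>\<^bsub>A\<^esub> j = \<zero>\<^bsub>A\<^esub>"
    by (simp add: ideal_prod_zero_iff)
  let ?I = "I \<inter> a_kernel A A d" and ?J = "J \<inter> a_kernel A A d"
  have gr: "graded_ideal ?I (ker_ring A d) (ker_grading A G d)"
    "graded_ideal ?J (ker_ring A d) (ker_grading A G d)"
    using I J graded_ideal_Int_ker by (auto simp: dg_ideal_def)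
  then have "ideal ?I (ker_ring A d)" "ideal ?J (ker_ring A d)"
    by (auto simp: graded_ideal_def)
  \<comment> \<open>The kernel inherits multiplication and zero from \<open>A\<close>, so the
    vanishing products of \<open>I\<close> and \<open>J\<close> restrict to \<open>?I\<close> and
    \<open>?J\<close>.\<close>
  then have "ideal_prod (ker_ring A d) ?I ?J = {\<zero>\<^bsub>ker_ring A d\<^esub>}"
    using IJ by (simp add: B.ideal_prod_zero_iff) (simp add: ker_ring_def)
  with gr have "?I = {\<zero>\<^bsub>ker_ring A d\<^esub>} \<or> ?J = {\<zero>\<^bsub>ker_ring A d\<^esub>}"
    using assms(2) by (simp add: gr_prime_def)
  then have "?I = {\<zero>\<^bsub>A\<^esub>} \<or> ?J = {\<zero>\<^bsub>A\<^esub>}"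
    by (simp add: ker_ring_def)
  then show "I = {\<zero>\<^bsub>A\<^esub>} \<or> J = {\<zero>\<^bsub>A\<^esub>}"
    using I J dg_ideal_eq_zeroI by blast
qed

end
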